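(* For every positive integer $n$ and every integer $k\ge3$, $$N_P(n,k,k+2)\ \ge\ \Bigl(k-2+\frac{4k+16}{3k^2+k+4}\Bigr)n.$$
   Context: Fix a finite field $\mathbb{F}_q$; $[n]=\{1,\dots,n\}$. An $(n,N,k,m)$-PIR array code over $\mathbb{F}_q$ is an $\mathbb{F}_q$-linear map $\mathcal{C}:\mathbf x\in\mathbb{F}_q^n\mapsto(\mathbf c_1,\dots,\mathbf c_m)$ with buckets $\mathbf c_\ell\in\mathbb{F}_q^{N_\ell}$, $N_\ell\ge1$ independent of $\mathbf x$, $\sum_\ell N_\ell=N$, such that for every $i\in[n]$ there is a partition of $[m]$ into $k$ sets $R_1,\dots,R_k$ such that for each $j$, $x_i$ is an $\mathbb{F}_q$-linear combination of values $f_\ell(\mathbf c_\ell)$, $\ell\in R_j$, for some linear functionals $f_\ell:\mathbb{F}_q^{N_\ell}\to\mathbb{F}_q$ (independent of $\mathbf x$). $N_P(n,k,m)$ denotes the minimum $N$ for which an $(n,N,k,m)$-PIR array code over $\mathbb{F}_q$ exists. *)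

theory Defs
  imports Complex_Main
begin

text \<open>Coordinates of the message are x 1, ..., x n; buckets are indexed by 1..m.
  Bucket l has Nl l coordinates; its t-th coordinate is the linear form
  sum over s in 1..n of G l t s * x s (every linear map F^n -> F^(Nl l) has this form).
  A linear functional on bucket l is given by coefficients f l t.\<close>

definition bucket_val :: "nat \<Rightarrow> (nat \<Rightarrow> nat) \<Rightarrow> (nat \<Rightarrow> nat \<Rightarrow> nat \<Rightarrow> 'a::field)
    \<Rightarrow> nat \<Rightarrow> (nat \<Rightarrow> 'a) \<Rightarrow> nat \<Rightarrow> 'a" where
  "bucket_val n Nl G l x t = (\<Sum>s=1..n. G l t s * x s)"

definition is_partition_k :: "nat \<Rightarrow> nat \<Rightarrow> (nat \<Rightarrow> nat set) \<Rightarrow> bool" where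
  "is_partition_k m k R \<longleftrightarrow>
     (\<forall>j\<in>{1..k}. R j \<noteq> {}) \<and>
     (\<forall>j\<in>{1..k}. \<forall>j'\<in>{1..k}. j \<noteq> j' \<longrightarrow> R j \<inter> R j' = {}) \<and>
     (\<Union>j\<in>{1..k}. R j) = {1..m}"

definition pir_array_code ::
  "nat \<Rightarrow> nat \<Rightarrow> nat \<Rightarrow> nat \<Rightarrow> (nat \<Rightarrow> nat) \<Rightarrow> (nat \<Rightarrow> nat \<Rightarrow> nat \<Rightarrow> 'a::{finite,field}) \<Rightarrow> bool" where
  "pir_array_code n N k m Nl G \<longleftrightarrow>
     (\<forall>l\<in>{1..m}. Nl l \<ge> 1) \<and> (\<Sum>l=1..m. Nl l) = N \<and>
     (\<forall>i\<in>{1..n}. \<exists>R. is_partition_k m k R \<and>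
        (\<forall>j\<in>{1..k}. \<exists>(f :: nat \<Rightarrow> nat \<Rightarrow> 'a) (c :: nat \<Rightarrow> 'a).
           \<forall>x :: nat \<Rightarrow> 'a. x i = (\<Sum>l\<in>R j. c l * (\<Sum>t=1..Nl l. f l t * bucket_val n Nl G l x t))))"

definition N_P :: "'a::{finite,field} itself \<Rightarrow> nat \<Rightarrow> nat \<Rightarrow> nat \<Rightarrow> nat" where
  "N_P _ n k m = (LEAST N. \<exists>Nl (G :: nat \<Rightarrow> nat \<Rightarrow> nat \<Rightarrow> 'a). pir_array_code n N k m Nl G)"

end

theory Submission
  imports Defs "HOL-Library.Function_Algebras"
begin

text \<open>Let \<open>V a\<close> be the span of the linear forms stored in bucket \<open>a\<close> and \<open>K U\<close> the set of
  coordinates \<open>i\<close> whose unit form lies in the span of the buckets in \<open>U\<close>. Submodularity of the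
  dimension gives for any three buckets
  \<open>2 (N a + N b + N c) \<ge> |K a \<inter> K b| + |K a \<inter> K c| + |K b \<inter> K c| + 2 |K abc| + |K ab \<inter> K ac \<inter> K bc|\<close>.
  Sum this over all triples \<open>T\<close>. A coordinate recovered alone by a set \<open>S\<close> of buckets contributes at least
  \<open>2 |S \<inter> T|\<close> to the right-hand side. In a partition of \<open>k + 2\<close> buckets into \<open>k\<close> parts either
  \<open>|S| \<ge> k - 1\<close>, or \<open>|S| = k - 2\<close> and there are two pairs \<open>P\<close>, \<open>Q\<close>; in the latter case the
  contribution increases by one for each of \<open>P \<subseteq> T\<close>, \<open>Q \<subseteq> T\<close> and \<open>T \<subseteq> P \<union> Q\<close>, in total by \<open>2 k + 4\<close>.
  Hence \<open>N \<ge> (k - 2 + (2 k + 4) / (k (k + 1))) n\<close>, which exceeds the claimed bound for \<open>k \<ge> 3\<close>.\<close>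

section \<open>Submodularity of dimension\<close>

context vector_space
begin

lemma finite_independent_subset_span:
  assumes "finite F" "B \<subseteq> span F" "independent B"
  shows "finite B"
  using independent_span_bound[of F B] assms by auto

text \<open>\<open>dim\<close> is the cardinality of a basis, hence 0 when bases are infinite, so it
  is not monotone in general. The finite \<open>F\<close> forces every independent set in its span
  to be finite.\<close>

lemma dim_mono_finite_span:
  assumes "finite F" "W \<subseteq> span F" "V \<subseteq> span W"
  shows "dim V \<le> dim W"
proof -
  obtain B where B: "B \<subseteq> W" "independent B" "W \<subseteq> span B" "card B = dim W"
    using basis_exists by blast
  have "finite B"
    using finite_independent_subset_span assms B by blast
  moreover have "V \<subseteq> span B"
    using assms(3) B(3) by (meson order_trans span_minimal subspace_span)
  ultimately show ?thesis
    using dim_le_card[of V B] B(4) by simp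
qed

lemma card_independent_le_dim:
  assumes "finite F" "W \<subseteq> span F" "B \<subseteq> span W" "independent B"
  shows "card B \<le> dim W"
  using dim_mono_finite_span[of F W B] assms dim_eq_card_independent by simp

text \<open>A basis \<open>C\<close> of \<open>Z\<close> extends to bases \<open>D\<close> of
  \<open>span X\<close> and \<open>E\<close> of \<open>span Y\<close>. Then
  \<open>D \<union> E\<close> spans \<open>X\<close> and \<open>Y\<close>, while
  \<open>D \<inter> E\<close> contains \<open>C\<close>; inclusion-exclusion for \<open>D\<close>
  and \<open>E\<close> finishes. Since \<open>Z\<close> is any set inside both spans, independent
  vectors lying in both can take its place.\<close>

lemma dim_submodular:
  assumes "finite F" "X \<subseteq> span F" "Y \<subseteq> span F" "Z \<subseteq> span X" "Z \<subseteq> span Y"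
  shows "dim (X \<union> Y) + dim Z \<le> dim X + dim Y"
proof -
  obtain C where C: "C \<subseteq> Z" "independent C" "Z \<subseteq> span C" "card C = dim Z"
    using basis_exists by blast
  obtain D where D: "C \<subseteq> D" "D \<subseteq> span X" "independent D" "span X \<subseteq> span D"
    using maximal_independent_subset_extend[OF subset_trans[OF C(1) assms(4)] C(2)] by blast
  obtain E where E: "C \<subseteq> E" "E \<subseteq> span Y" "independent E" "span Y \<subseteq> span E"
    using maximal_independent_subset_extend[OF subset_trans[OF C(1) assms(5)] C(2)] by blast
  have spX: "span X \<subseteq> span F" and spY: "span Y \<subseteq> span F"
    using assms by (simp_all add: span_minimal)
  have fin: "finite D" "finite E"
    using finite_independent_subset_span[OF assms(1) subset_trans[OF D(2) spX] D(3)]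
      finite_independent_subset_span[OF assms(1) subset_trans[OF E(2) spY] E(3)] by simp_all
  have "X \<union> Y \<subseteq> span (D \<union> E)"
    using span_superset[of X] span_superset[of Y] D(4) E(4)
      span_mono[OF Un_upper1, of D E] span_mono[OF Un_upper2, of E D]
    by (meson Un_least order_trans)
  then have "dim (X \<union> Y) \<le> card (D \<union> E)"
    using fin by (intro dim_le_card) auto
  moreover have "card C \<le> card (D \<inter> E)"
    using D(1) E(1) fin by (intro card_mono) auto
  moreover have "card (D \<union> E) + card (D \<inter> E) = card D + card E"
    using card_Un_Int[OF fin] by simp
  moreover have "card D = dim X" "card E = dim Y"
    using D E by (metis dim_span basis_card_eq_dim)+
  ultimately show ?thesis
    using C(4) by linarith
qed

text \<open>The triple intersection enters because
  \<open>span (A \<union> B) \<inter> span (A \<union> C)\<close> contains \<open>A\<close>, so together with \<open>B \<union> C\<close> it still spans everything.\<close>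

lemma three_spans_bound:
  assumes fin: "finite A" "finite B" "finite C" and E: "independent E"
  shows "card (E \<inter> (span A \<inter> span B)) + card (E \<inter> (span A \<inter> span C)) + card (E \<inter> (span B \<inter> span C))
      + 2 * card (E \<inter> span (A \<union> B \<union> C))
      + card (E \<inter> (span (A \<union> B) \<inter> span (A \<union> C) \<inter> span (B \<union> C)))
      \<le> 2 * (card A + card B + card C)"
proof -
  define F where "F = A \<union> B \<union> C"
  define Z where "Z = span (A \<union> B) \<inter> span (A \<union> C)"
  have F: "finite F" "A \<subseteq> span F" "B \<subseteq> span F" "C \<subseteq> span F"
    using fin by (auto simp: F_def intro: span_base)
  have indep: "independent (E \<inter> X)" for X
    using E independent_mono by blast
  \<comment> \<open>Submodularity with \<open>Z\<close> taken as the members of \<open>E\<close> in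
    both spans; being independent, they have dimension equal to their number.\<close>
  have pair: "dim (X \<union> Y) + card (E \<inter> (span X \<inter> span Y)) \<le> card X + card Y"
    if "finite X" "finite Y" "X \<subseteq> span F" "Y \<subseteq> span F" for X Y
  proof -
    have "dim (X \<union> Y) + dim (E \<inter> (span X \<inter> span Y)) \<le> dim X + dim Y"
      using that by (intro dim_submodular[OF F(1)]) auto
    then show ?thesis
      using dim_le_card'[OF that(1)] dim_le_card'[OF that(2)]
        dim_eq_card_independent[OF indep] by simp
  qed
  have Z: "Z \<subseteq> span F"
    unfolding Z_def F_def using span_mono[of "A \<union> B" "A \<union> B \<union> C"] by blast
  \<comment> \<open>Added to the inequality for \<open>Z\<close> and \<open>B \<union> C\<close>
    below, this cancels \<open>dim Z\<close>. What remains bounds \<open>2 * dim F\<close> plus the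
    triple term by the sum of the three pairwise dimensions, which \<open>pair\<close>
    controls.\<close>
  have "dim ((A \<union> B) \<union> (A \<union> C)) + dim Z \<le> dim (A \<union> B) + dim (A \<union> C)"
    using F by (intro dim_submodular[OF F(1)]) (auto simp: Z_def)
  moreover have "(A \<union> B) \<union> (A \<union> C) = F"
    by (auto simp: F_def)
  moreover have "dim (Z \<union> (B \<union> C)) + dim (E \<inter> (Z \<inter> span (B \<union> C))) \<le> dim Z + dim (B \<union> C)"
    using F Z by (intro dim_submodular[OF F(1)]) (auto intro: span_base)
  moreover have "dim F \<le> dim (Z \<union> (B \<union> C))"
    using F Z by (intro dim_mono_finite_span[OF F(1)]) (auto simp: F_def Z_def intro: span_base)
  moreover have "card (E \<inter> span F) \<le> dim F"
    using indep by (intro card_independent_le_dim[OF F(1)]) (auto intro: span_base)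
  ultimately show ?thesis
    using pair[of A B] pair[of A C] pair[of B C] F fin dim_eq_card_independent[OF indep, of "Z \<inter> span (B \<union> C)"]
    by (simp add: F_def Z_def)
qed

end

section \<open>Counting triples of buckets\<close>

text \<open>With \<open>p U\<close> meaning that a fixed coordinate is recoverable from the buckets
  in \<open>U\<close>, this is the contribution of that coordinate to the left-hand side of
  \<open>three_spans_bound\<close>.\<close>

definition triple_count :: "('b set \<Rightarrow> bool) \<Rightarrow> 'b \<Rightarrow> 'b \<Rightarrow> 'b \<Rightarrow> nat" where
  "triple_count p a b c =
     of_bool (p {a} \<and> p {b}) + of_bool (p {a} \<and> p {c}) + of_bool (p {b} \<and> p {c})
     + 2 * of_bool (p {a, b, c}) + of_bool (p {a, b} \<and> p {a, c} \<and> p {b, c})"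

lemma triple_count_commute:
  "triple_count p a b c = triple_count p a c b" "triple_count p a b c = triple_count p b a c"
  by (auto simp: triple_count_def insert_commute)

lemma card_Int_triple:
  assumes "a \<noteq> b" "a \<noteq> c" "b \<noteq> c"
  shows "card (S \<inter> {a, b, c}) = of_bool (a \<in> S) + of_bool (b \<in> S) + of_bool (c \<in> S)"
  using assms by (auto simp: Int_insert_right)

text \<open>One element of \<open>S\<close> in the triple already gives 2 through
  \<open>p {a, b, c}\<close>. A second one adds a common pair and makes all three two-bucket sets
  recover, giving 4; a third adds two more common pairs, giving 6.\<close>

lemma triple_count_ge_singles:
  assumes "mono p" "\<And>l. l \<in> S \<Longrightarrow> p {l}" "a \<noteq> b" "a \<noteq> c" "b \<noteq> c"
  shows "2 * card (S \<inter> {a, b, c}) \<le> triple_count p a b c"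
proof -
  have mono: "p U \<Longrightarrow> U \<subseteq> V \<Longrightarrow> p V" for U V
    using assms(1) by (auto simp: mono_def le_bool_def)
  have up: "p U" if "x \<in> S" "x \<in> U" for x U
    using mono[of "{x}" U] assms(2) that by simp
  show ?thesis
    unfolding card_Int_triple[OF assms(3-5)] triple_count_def
    using up by (cases "a \<in> S"; cases "b \<in> S"; cases "c \<in> S") simp_all
qed

text \<open>If \<open>c\<close> is not in \<open>S\<close>, the 2 from \<open>p {a, b, c}\<close>
  suffices. If \<open>c\<close> is in \<open>S\<close>, the last term of \<open>triple_count\<close>
  supplies the additional 1, because \<open>{a, c}\<close> and \<open>{b, c}\<close> recover through
  \<open>c\<close>. The extra unit for a triple avoiding \<open>S\<close> later pays for triples
  inside the union of two pairs.\<close>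

lemma triple_count_ge_pair:
  assumes "mono p" "\<And>l. l \<in> S \<Longrightarrow> p {l}" "a \<noteq> b" "a \<noteq> c" "b \<noteq> c"
    and "p {a, b}" "a \<notin> S" "b \<notin> S"
  shows "2 * card (S \<inter> {a, b, c}) + 1 + of_bool (c \<notin> S) \<le> triple_count p a b c"
proof -
  have mono: "p U \<Longrightarrow> U \<subseteq> V \<Longrightarrow> p V" for U V
    using assms(1) by (auto simp: mono_def le_bool_def)
  have "p {a, b, c}"
    using mono[of "{a, b}"] assms(6) by blast
  moreover have "p {a, c} \<and> p {b, c}" if "c \<in> S"
    using mono[of "{c}"] assms(2)[OF that] by blast
  ultimately show ?thesis
    unfolding card_Int_triple[OF assms(3-5)]
    using assms(6-8) by (auto simp: triple_count_def)
qed

lemma triple_count_ge_pair_subset: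
  assumes "mono p" "\<And>l. l \<in> S \<Longrightarrow> p {l}" "a \<noteq> b" "a \<noteq> c" "b \<noteq> c"
    and P: "card P = 2" "P \<subseteq> {a, b, c}" "p P" "P \<inter> S = {}"
  shows "2 * card (S \<inter> {a, b, c}) + 1 + of_bool ({a, b, c} \<inter> S = {}) \<le> triple_count p a b c"
proof -
  consider "P = {a, b}" | "P = {a, c}" | "P = {b, c}"
    using P(1,2) unfolding card_2_iff by blast
  then show ?thesis
  proof cases
    case 1
    then show ?thesis
      using triple_count_ge_pair[of p S a b c] assms by auto
  next
    case 2
    then show ?thesis
      using triple_count_ge_pair[of p S a c b] assms
      by (auto simp: insert_commute triple_count_commute(1)[of p a b c])
  next
    case 3
    have "triple_count p a b c = triple_count p b c a"
      by (metis triple_count_commute)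
    moreover have "{b, c, a} = {a, b, c}"
      by blast
    ultimately show ?thesis
      using triple_count_ge_pair[of p S b c a] assms 3 by auto
  qed
qed

text \<open>A triple cannot contain both disjoint pairs. A triple inside \<open>P \<union> Q\<close>
  omits only one of four elements, so it contains one of the pairs and avoids \<open>S\<close>; the
  extra unit of \<open>triple_count_ge_pair_subset\<close> then covers the last term.\<close>

lemma triple_count_ge_two_pairs:
  assumes "mono p" "\<And>l. l \<in> S \<Longrightarrow> p {l}" and d: "a \<noteq> b" "a \<noteq> c" "b \<noteq> c"
    and P: "card P = 2" "p P" and Q: "card Q = 2" "p Q"
    and disj: "P \<inter> Q = {}" "P \<inter> S = {}" "Q \<inter> S = {}"
  shows "2 * card (S \<inter> {a, b, c}) + of_bool (P \<subseteq> {a, b, c}) + of_bool (Q \<subseteq> {a, b, c})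
      + of_bool ({a, b, c} \<subseteq> P \<union> Q) \<le> triple_count p a b c"
proof -
  let ?T = "{a, b, c}"
  have fin: "finite P" "finite Q"
    using P(1) Q(1) by (auto intro: card_ge_0_finite)
  have cT: "card ?T = 3"
    using d by simp
  have not_both: "\<not> (P \<subseteq> ?T \<and> Q \<subseteq> ?T)"
    using card_mono[of ?T "P \<union> Q"] card_Un_disjoint[OF fin disj(1)] P Q cT by auto
  have inside: "P \<subseteq> ?T \<or> Q \<subseteq> ?T" if "?T \<subseteq> P \<union> Q"
  proof -
    have "card (P \<union> Q - ?T) = 1"
      using card_Diff_subset[of ?T "P \<union> Q"] that card_Un_disjoint[OF fin disj(1)] P Q cT by auto
    then obtain z where "P \<union> Q - ?T = {z}"
      using card_1_singletonE by blast
    then have "x = z" if "x \<in> P \<union> Q" "x \<notin> ?T" for x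
      using that by blast
    then show ?thesis
      using disj(1) by (metis UnCI disjoint_iff subsetI)
  qed
  have avoid: "?T \<inter> S = {}" if "?T \<subseteq> P \<union> Q"
    using that disj by blast
  show ?thesis
  proof (cases "P \<subseteq> ?T")
    case True
    then have "\<not> Q \<subseteq> ?T" using not_both by blast
    then show ?thesis
      using triple_count_ge_pair_subset[OF assms(1-5) P(1) True P(2) disj(2)] True avoid
      by (auto split: if_splits)
  next
    case nP: False
    show ?thesis
    proof (cases "Q \<subseteq> ?T")
      case True
      then show ?thesis
        using triple_count_ge_pair_subset[OF assms(1-5) Q(1) True Q(2) disj(3)] nP avoid
        by (auto split: if_splits)
    next
      case False
      then show ?thesis
        using triple_count_ge_singles[OF assms(1-5)] nP inside by auto
    qed
  qed
qed

section \<open>Binomial counts of triples\<close>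

lemma card_subsets_between:
  assumes "finite M" "P \<subseteq> M" "card P \<le> r"
  shows "card {T. P \<subseteq> T \<and> T \<subseteq> M \<and> card T = r} = (card M - card P) choose (r - card P)"
proof -
  have fP: "finite P" using assms finite_subset by blast
  have "bij_betw (\<lambda>U. U \<union> P) {U. U \<subseteq> M - P \<and> card U = r - card P}
     {T. P \<subseteq> T \<and> T \<subseteq> M \<and> card T = r}"
  proof (rule bij_betw_byWitness[where f' = "\<lambda>T. T - P"])
    show "(\<lambda>U. U \<union> P) ` {U. U \<subseteq> M - P \<and> card U = r - card P} \<subseteq> {T. P \<subseteq> T \<and> T \<subseteq> M \<and> card T = r}"
    proof clarsimp
      fix U assume U: "U \<subseteq> M - P" "card U = r - card P"
      then have "finite U" using assms finite_subset by blast
      then have "card (U \<union> P) = card U + card P"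
        using U fP by (intro card_Un_disjoint) auto
      then show "U \<subseteq> M \<and> P \<subseteq> M \<and> card (U \<union> P) = r"
        using U assms by auto
    qed
    show "(\<lambda>T. T - P) ` {T. P \<subseteq> T \<and> T \<subseteq> M \<and> card T = r} \<subseteq> {U. U \<subseteq> M - P \<and> card U = r - card P}"
      using fP by (auto simp: card_Diff_subset)
  qed auto
  then have "card {T. P \<subseteq> T \<and> T \<subseteq> M \<and> card T = r} = card {U. U \<subseteq> M - P \<and> card U = r - card P}"
    by (rule bij_betw_same_card[symmetric])
  also have "\<dots> = (card M - card P) choose (r - card P)"
    using assms fP n_subsets[of "M - P" "r - card P"] by (simp add: card_Diff_subset)
  finally show ?thesis .
qed

abbreviation triples :: "'b set \<Rightarrow> 'b set set" where
  "triples M \<equiv> {T. T \<subseteq> M \<and> card T = 3}"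

text \<open>Double counting: each element of \<open>M\<close> lies in
  \<open>(card M - 1) choose 2\<close> triples.\<close>

lemma sum_triples_sum:
  fixes w :: "'b \<Rightarrow> nat"
  assumes "finite M"
  shows "(\<Sum>T\<in>triples M. \<Sum>l\<in>T. w l) = ((card M - 1) choose 2) * (\<Sum>l\<in>M. w l)"
proof -
  have fin: "finite (triples M)"
    using assms by auto
  have "(\<Sum>T\<in>triples M. \<Sum>l\<in>T. w l) = (\<Sum>T\<in>triples M. \<Sum>l\<in>M. w l * of_bool (l \<in> T))"
  proof (rule sum.cong[OF refl])
    fix T assume "T \<in> triples M"
    then have "(\<Sum>l\<in>T. w l) = (\<Sum>l\<in>M. if l \<in> T then w l else 0)"
      using assms by (auto simp: Int_absorb1 simp flip: sum.inter_restrict)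
    then show "(\<Sum>l\<in>T. w l) = (\<Sum>l\<in>M. w l * of_bool (l \<in> T))"
      by (auto intro: sum.cong)
  qed
  also have "\<dots> = (\<Sum>l\<in>M. w l * (\<Sum>T\<in>triples M. of_bool (l \<in> T)))"
    by (subst sum.swap) (simp add: sum_distrib_left)
  also have "\<dots> = (\<Sum>l\<in>M. w l * ((card M - 1) choose 2))"
  proof (intro sum.cong refl)
    fix l assume "l \<in> M"
    then have "card {T. {l} \<subseteq> T \<and> T \<subseteq> M \<and> card T = 3} = (card M - 1) choose 2"
      using card_subsets_between[OF assms, of "{l}" 3] by simp
    moreover have "triples M \<inter> {T. l \<in> T} = {T. {l} \<subseteq> T \<and> T \<subseteq> M \<and> card T = 3}"
      by auto
    ultimately show "w l * (\<Sum>T\<in>triples M. of_bool (l \<in> T)) = w l * ((card M - 1) choose 2)"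
      using fin by simp
  qed
  finally show ?thesis
    by (simp only: sum_distrib_right mult.commute)
qed

lemma sum_triples_card_Int:
  assumes "finite M" "S \<subseteq> M"
  shows "(\<Sum>T\<in>triples M. card (S \<inter> T)) = ((card M - 1) choose 2) * card S"
proof -
  have "card (S \<inter> T) = (\<Sum>l\<in>T. of_bool (l \<in> S))" if "T \<in> triples M" for T
    using that assms finite_subset[of T M] by (simp add: Int_commute)
  then have "(\<Sum>T\<in>triples M. card (S \<inter> T)) = (\<Sum>T\<in>triples M. \<Sum>l\<in>T. of_bool (l \<in> S))"
    by simp
  also have "\<dots> = ((card M - 1) choose 2) * card S"
    unfolding sum_triples_sum[OF assms(1)] using assms by (simp add: Int_absorb1)
  finally show ?thesis .
qed

section \<open>Partitions of k + 2 buckets into k parts\<close>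

text \<open>The sizes of the parts exceed 1 by a total of 2, so at most two parts are not
  singletons, and if there are two, both are pairs. \<open>S\<close> is the union of the singleton
  parts.\<close>

lemma partition_cases:
  assumes "is_partition_k (k + 2) k R"
  obtains (singles) S where "S \<subseteq> {1..k+2}" "card S \<ge> k - 1" "\<And>l. l \<in> S \<Longrightarrow> \<exists>j\<in>{1..k}. R j = {l}"
  | (pairs) S i j where "S \<subseteq> {1..k+2}" "card S \<ge> k - 2" "\<And>l. l \<in> S \<Longrightarrow> \<exists>j\<in>{1..k}. R j = {l}"
      "i \<in> {1..k}" "j \<in> {1..k}" "card (R i) = 2" "card (R j) = 2"
      "R i \<inter> R j = {}" "R i \<inter> S = {}" "R j \<inter> S = {}"
proof -
  have ne: "R j \<noteq> {}" if "j \<in> {1..k}" for j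
    using assms that by (auto simp: is_partition_k_def)
  have dj: "R i \<inter> R j = {}" if "i \<in> {1..k}" "j \<in> {1..k}" "i \<noteq> j" for i j
    using assms that by (auto simp: is_partition_k_def)
  have un: "(\<Union>j\<in>{1..k}. R j) = {1..k+2}"
    using assms by (auto simp: is_partition_k_def)
  have sub: "R j \<subseteq> {1..k+2}" if "j \<in> {1..k}" for j
    using un that by blast
  have fin: "finite (R j)" if "j \<in> {1..k}" for j
    using sub[OF that] finite_subset by blast
  define J where "J = {j \<in> {1..k}. card (R j) = 1}"
  define H where "H = {1..k} - J"
  define S where "S = (\<Union>j\<in>J. R j)"
  have J: "J \<subseteq> {1..k}" "finite J" "finite H"
    by (auto simp: J_def H_def)
  have cS: "card S = card J"
    unfolding S_def using J fin dj
    by (subst card_UN_disjoint) (auto simp: J_def)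
  have S: "S \<subseteq> {1..k+2}" "\<And>l. l \<in> S \<Longrightarrow> \<exists>j\<in>{1..k}. R j = {l}"
    unfolding S_def J_def using sub by (blast, fastforce simp: card_1_singleton_iff)
  have tot: "(\<Sum>j\<in>{1..k}. card (R j)) = k + 2"
    using card_UN_disjoint[of "{1..k}" R] fin dj un by auto
  have "(\<Sum>j\<in>{1..k}. card (R j)) = (\<Sum>j\<in>J. card (R j)) + (\<Sum>j\<in>H. card (R j))"
    unfolding H_def using J by (metis finite_atLeastAtMost sum.subset_diff add.commute)
  then have tot': "card J + (\<Sum>j\<in>H. card (R j)) = k + 2"
    using tot by (simp add: J_def)
  have cH: "card H + card J = k"
    unfolding H_def using J card_mono[of "{1..k}" J] by (simp add: card_Diff_subset)
  have ge2: "card (R j) \<ge> 2" if "j \<in> H" for j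
  proof -
    have "card (R j) \<noteq> 0" "card (R j) \<noteq> 1"
      using that ne fin by (auto simp: H_def J_def)
    then show ?thesis by linarith
  qed
  show thesis
  proof (cases "card J \<ge> k - 1")
    case True
    then show thesis
      using singles[of S] S cS by simp
  next
    case False
    \<comment> \<open>The sizes over \<open>H\<close> sum to \<open>card H + 2\<close>, so this
      gives \<open>card H \<le> 2\<close>; fewer than \<open>k - 1\<close> singletons gives
      \<open>card H \<ge> 2\<close>.\<close>
    have "(\<Sum>j\<in>H. 2) \<le> (\<Sum>j\<in>H. card (R j))"
      using ge2 by (rule sum_mono)
    then have H2: "card H = 2"
      using False cH tot' by simp
    then obtain i j where ij: "H = {i, j}" "i \<noteq> j"
      by (meson card_2_iff)
    have "card (R i) + card (R j) = 4"
      using tot' cH H2 ij by simp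
    then have "card (R i) = 2" "card (R j) = 2"
      using ge2[of i] ge2[of j] ij by auto
    moreover have "i \<in> {1..k}" "j \<in> {1..k}" "i \<notin> J" "j \<notin> J"
      using ij by (auto simp: H_def)
    moreover have "R i \<inter> S = {}" "R j \<inter> S = {}"
      unfolding S_def using calculation J dj by blast+
    ultimately show thesis
      using pairs[of S i j] S cS cH H2 dj ij by simp
  qed
qed

lemma choose_two_double: "2 * ((k + 1) choose 2) = k * (k + 1)"
  by (induction k) (simp_all add: numeral_2_eq_2 algebra_simps)

text \<open>\<open>triple_count\<close> takes its buckets in order, so its lower bounds are passed
  on as a function \<open>h\<close> of the set of buckets, which can be summed over triples.\<close>

lemma triple_count_partition:
  assumes "k \<ge> 3" "is_partition_k (k + 2) k R" "mono p" "\<And>j. j \<in> {1..k} \<Longrightarrow> p (R j)"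
  obtains h where
    "\<And>a b c. \<lbrakk>a \<noteq> b; a \<noteq> c; b \<noteq> c\<rbrakk> \<Longrightarrow> h {a, b, c} \<le> triple_count p a b c"
    "(k - 2) * (k * (k + 1)) + 2 * k + 4 \<le> (\<Sum>T\<in>triples {1..k+2}. h T)"
  using assms(2)
proof (cases rule: partition_cases)
  case (singles S)
  define h where "h = (\<lambda>T. 2 * card (S \<inter> T))"
  have pS: "p {l}" if "l \<in> S" for l
    using singles(3)[OF that] assms(4) by metis
  have "(\<Sum>T\<in>triples {1..k+2}. h T) = 2 * (((k + 1) choose 2) * card S)"
    unfolding h_def sum_distrib_left[symmetric]
    by (subst sum_triples_card_Int) (use singles in auto)
  also have "\<dots> = k * (k + 1) * card S"
    by (metis choose_two_double mult.assoc)
  also have "\<dots> \<ge> k * (k + 1) * (k - 1)"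
    using singles(2) by (rule mult_le_mono2)
  finally have "k * (k + 1) * (k - 1) \<le> (\<Sum>T\<in>triples {1..k+2}. h T)" .
  \<comment> \<open>The difference is \<open>k * (k + 1) - (2 * k + 4)\<close>: it is 2 at
    \<open>k = 3\<close> and grows from there, but is negative at \<open>k = 2\<close>.\<close>
  moreover have "(k - 2) * (k * (k + 1)) + 2 * k + 4 \<le> k * (k + 1) * (k - 1)"
  proof -
    obtain r where "k = r + 3"
      using assms(1) by (metis add.commute le_Suc_ex)
    then show ?thesis by (simp add: algebra_simps)
  qed
  ultimately show thesis
    using that[of h] triple_count_ge_singles[OF assms(3) pS] by (simp add: h_def)
next
  case (pairs S i j)
  let ?M = "{1..k+2}" and ?P = "R i" and ?Q = "R j"
  define h where "h = (\<lambda>T. 2 * card (S \<inter> T) + of_bool (?P \<subseteq> T) + of_bool (?Q \<subseteq> T)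
      + of_bool (T \<subseteq> ?P \<union> ?Q))"
  have pS: "p {l}" if "l \<in> S" for l
    using pairs(3)[OF that] assms(4) by metis
  have bound: "h {a, b, c} \<le> triple_count p a b c" if "a \<noteq> b" "a \<noteq> c" "b \<noteq> c" for a b c
    unfolding h_def using pS that pairs assms
    by (intro triple_count_ge_two_pairs) auto
  have sub: "?P \<subseteq> ?M" "?Q \<subseteq> ?M"
    using assms(2) pairs(4,5) unfolding is_partition_k_def by blast+
  have fin: "finite (triples ?M)"
    by simp
  \<comment> \<open>The third bucket of \<open>T\<close> is any of the \<open>k\<close> buckets
    outside \<open>X\<close>.\<close>
  have above: "(\<Sum>T\<in>triples ?M. of_bool (X \<subseteq> T)) = k" if "X \<subseteq> ?M" "card X = 2" for X
  proof -
    have "triples ?M \<inter> {T. X \<subseteq> T} = {T. X \<subseteq> T \<and> T \<subseteq> ?M \<and> card T = 3}"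
      by auto
    then show ?thesis
      using card_subsets_between[of ?M X 3] that fin by simp
  qed
  \<comment> \<open>A four-element set has four triples; with \<open>above\<close> for both pairs
    the surplus is \<open>k + k + 4\<close>.\<close>
  have "triples ?M \<inter> {T. T \<subseteq> ?P \<union> ?Q} = {T. T \<subseteq> ?P \<union> ?Q \<and> card T = 3}"
    using sub by auto
  moreover have "card (?P \<union> ?Q) = 4" "finite (?P \<union> ?Q)"
    using pairs sub finite_subset[of ?P ?M] finite_subset[of ?Q ?M]
    by (auto simp: card_Un_disjoint)
  ultimately have below: "(\<Sum>T\<in>triples ?M. of_bool (T \<subseteq> ?P \<union> ?Q)) = (4::nat)"
    using n_subsets[of "?P \<union> ?Q" 3] fin by (simp add: numeral_eq_Suc)
  have "(\<Sum>T\<in>triples ?M. 2 * card (S \<inter> T)) = 2 * (((k + 1) choose 2) * card S)"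
    unfolding sum_distrib_left[symmetric]
    by (subst sum_triples_card_Int) (use pairs in auto)
  also have "\<dots> = k * (k + 1) * card S"
    by (metis choose_two_double mult.assoc)
  also have "\<dots> \<ge> k * (k + 1) * (k - 2)"
    using pairs(2) by (rule mult_le_mono2)
  finally have "k * (k + 1) * (k - 2) \<le> (\<Sum>T\<in>triples ?M. 2 * card (S \<inter> T))" .
  moreover have "(\<Sum>T\<in>triples ?M. h T) = (\<Sum>T\<in>triples ?M. 2 * card (S \<inter> T)) + k + k + 4"
    unfolding h_def sum.distrib above[OF sub(1) pairs(6)] above[OF sub(2) pairs(7)] below ..
  ultimately show thesis
    using that[of h] bound by (simp add: mult.commute)
qed

section \<open>The bound for array codes\<close>

interpretation fun_space: vector_space "\<lambda>c f (i::nat). (c::'a::field) * f i"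
  by unfold_locales (auto simp: fun_eq_iff algebra_simps)

definition unit_form :: "nat \<Rightarrow> nat \<Rightarrow> 'a::field" where
  "unit_form i = (\<lambda>s. of_bool (s = i))"

text \<open>Cut off outside \<open>{1..n}\<close> because \<open>bucket_val\<close> reads only these
  coordinates, whereas \<open>G\<close> may take any values elsewhere.\<close>

definition bucket_form :: "nat \<Rightarrow> (nat \<Rightarrow> nat \<Rightarrow> nat \<Rightarrow> 'a::field) \<Rightarrow> nat \<Rightarrow> nat \<Rightarrow> nat \<Rightarrow> 'a" where
  "bucket_form n G l t = (\<lambda>s. if s \<in> {1..n} then G l t s else 0)"

lemma inj_unit_form: "inj (unit_form :: nat \<Rightarrow> nat \<Rightarrow> 'a::field)"
  by (rule injI) (metis (mono_tags, lifting) of_bool_eq_iff unit_form_def)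

lemma sum_fun_apply: "(\<Sum>x\<in>A. f x) i = (\<Sum>x\<in>A. f x i)"
  for f :: "'b \<Rightarrow> 'c \<Rightarrow> 'd::comm_monoid_add"
  by (induction A rule: infinite_finite_induct) auto

text \<open>Evaluating a vanishing combination at \<open>i\<close> isolates the coefficient of
  \<open>unit_form i\<close>.\<close>

lemma independent_unit_form:
  "fun_space.independent (unit_form ` A :: (nat \<Rightarrow> 'a::field) set)"
  unfolding fun_space.independent_explicit_module
proof (intro allI impI)
  fix T :: "(nat \<Rightarrow> 'a) set" and u :: "(nat \<Rightarrow> 'a) \<Rightarrow> 'a" and e
  assume T: "finite T" "T \<subseteq> unit_form ` A" "e \<in> T"
    and 0: "(\<Sum>v\<in>T. (\<lambda>s. u v * v s)) = 0"
  obtain i where e: "e = unit_form i"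
    using T by blast
  have "0 = (\<Sum>v\<in>T. u v * v i)"
    using fun_cong[OF 0, of i] by (simp add: sum_fun_apply)
  also have "\<dots> = (\<Sum>v\<in>T. if v = unit_form i then u v else 0)"
  proof (intro sum.cong refl)
    fix v assume "v \<in> T"
    then obtain j where "v = unit_form j" using T by blast
    moreover have "unit_form j = (unit_form i :: nat \<Rightarrow> 'a) \<longleftrightarrow> j = i"
      using inj_unit_form by (rule inj_eq)
    moreover have "(unit_form j i :: 'a) = of_bool (i = j)"
      by (simp add: unit_form_def)
    ultimately show "u v * v i = (if v = unit_form i then u v else 0)"
      by auto
  qed
  also have "\<dots> = u (unit_form i)"
    using T e by simp
  finally show "u e = 0" by (simp add: e)
qed

lemma unit_form_in_span:
  fixes G :: "nat \<Rightarrow> nat \<Rightarrow> nat \<Rightarrow> 'a::field"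
  assumes i: "i \<in> {1..n}"
    and rec: "\<And>x. x i = (\<Sum>l\<in>U. c l * (\<Sum>t=1..Nl l. f l t * bucket_val n Nl G l x t))"
  shows "unit_form i \<in> fun_space.span (\<Union>l\<in>U. bucket_form n G l ` {1..Nl l})"
proof -
  define w where "w = (\<Sum>l\<in>U. \<Sum>t=1..Nl l. (\<lambda>s. (c l * f l t) * bucket_form n G l t s))"
  have "w \<in> fun_space.span (\<Union>l\<in>U. bucket_form n G l ` {1..Nl l})"
    unfolding w_def
    by (intro fun_space.span_sum fun_space.span_scale fun_space.span_base) blast
  moreover have "unit_form i = w"
  proof
    fix s
    \<comment> \<open>The recovery identity holds for every message, so testing it on the unit
      message at \<open>s\<close> reads off the coefficient at \<open>s\<close>. Here
      \<open>unit_form\<close> serves both as message and as form, with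
      \<open>unit_form i s = unit_form s i\<close>.\<close>
    have val: "bucket_val n Nl G l (unit_form s) t = bucket_form n G l t s" for l t
      by (simp add: bucket_val_def unit_form_def bucket_form_def if_distrib of_bool_def
          cong: if_cong)
    have "unit_form i s = (unit_form s i :: 'a)"
      by (simp add: unit_form_def eq_commute)
    also have "\<dots> = (\<Sum>l\<in>U. c l * (\<Sum>t=1..Nl l. f l t * bucket_form n G l t s))"
      by (subst rec) (simp only: val)
    also have "\<dots> = w s"
      unfolding w_def sum_fun_apply sum_distrib_left mult.assoc ..
    finally show "unit_form i s = w s" .
  qed
  ultimately show ?thesis by simp
qed

section \<open>Double counting over coordinates and triples\<close>

text \<open>The sum of \<open>h i T\<close> over coordinates \<open>i\<close> and triples
  \<open>T\<close> is bounded below coordinate by coordinate and above triple by triple. The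
  denominator \<open>k * (k + 1)\<close> is multiplied out to stay in the natural numbers.\<close>

lemma pir_array_code_bound:
  fixes G :: "nat \<Rightarrow> nat \<Rightarrow> nat \<Rightarrow> 'a::{finite,field}"
  assumes code: "pir_array_code n N k (k + 2) Nl G" and k: "k \<ge> 3"
  shows "n * ((k - 2) * (k * (k + 1)) + 2 * k + 4) \<le> k * (k + 1) * N"
proof -
  define V where "V l = bucket_form n G l ` {1..Nl l}" for l
  define p where "p i U \<longleftrightarrow> unit_form i \<in> fun_space.span (\<Union>l\<in>U. V l)" for i U
  define E :: "(nat \<Rightarrow> 'a) set" where "E = unit_form ` {1..n}"
  \<comment> \<open>Equal forms within a bucket collapse in \<open>V l\<close>, hence only an
    inequality.\<close>
  have V: "finite (V l)" "card (V l) \<le> Nl l" for l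
    using card_image_le[of "{1..Nl l}" "bucket_form n G l"] by (auto simp: V_def)
  have mono: "mono (p i)" for i
  proof (intro monoI le_boolI)
    fix U U' :: "nat set" assume "U \<subseteq> U'" "p i U"
    moreover from this have "(\<Union>l\<in>U. V l) \<subseteq> (\<Union>l\<in>U'. V l)" by blast
    ultimately show "p i U'"
      unfolding p_def using fun_space.span_mono by blast
  qed
  \<comment> \<open>Writing cardinalities as sums of indicators splits
    \<open>three_spans_bound\<close> into one \<open>triple_count\<close> per coordinate.\<close>
  have cE: "card (E \<inter> X) = (\<Sum>i=1..n. of_bool (unit_form i \<in> X))" for X
  proof -
    have "E \<inter> X = unit_form ` {i \<in> {1..n}. unit_form i \<in> X}"
      by (auto simp: E_def)
    then have "card (E \<inter> X) = card {i \<in> {1..n}. (unit_form i :: nat \<Rightarrow> 'a) \<in> X}"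
      by (simp add: card_image inj_on_subset[OF inj_unit_form])
    then show ?thesis by (simp add: Int_def conj_commute)
  qed
  have triple: "(\<Sum>i=1..n. triple_count (p i) a b c) \<le> 2 * (Nl a + Nl b + Nl c)" for a b c
  proof -
    have "(\<Sum>i=1..n. triple_count (p i) a b c) \<le> 2 * (card (V a) + card (V b) + card (V c))"
      using fun_space.three_spans_bound[OF V(1)[of a] V(1)[of b] V(1)[of c] independent_unit_form[of "{1..n}"]]
      unfolding E_def[symmetric] cE
      by (simp add: triple_count_def p_def sum.distrib sum_distrib_left Un_assoc)
    also have "\<dots> \<le> 2 * (Nl a + Nl b + Nl c)"
      by (intro mult_le_mono2 add_mono V(2))
    finally show ?thesis .
  qed
  define good where "good i h \<longleftrightarrow>
      (\<forall>a b c. a \<noteq> b \<longrightarrow> a \<noteq> c \<longrightarrow> b \<noteq> c \<longrightarrow> h {a, b, c} \<le> triple_count (p i) a b c) \<and>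
      (k - 2) * (k * (k + 1)) + 2 * k + 4 \<le> (\<Sum>T\<in>triples {1..k+2}. h T)" for i h
  have "\<exists>h. good i h" if i: "i \<in> {1..n}" for i
  proof -
    obtain R where R: "is_partition_k (k + 2) k R"
      and rec: "\<And>j. j \<in> {1..k} \<Longrightarrow> \<exists>f c. \<forall>x :: nat \<Rightarrow> 'a. x i =
        (\<Sum>l\<in>R j. c l * (\<Sum>t=1..Nl l. f l t * bucket_val n Nl G l x t))"
      using code i unfolding pir_array_code_def by meson
    have pR: "p i (R j)" if j: "j \<in> {1..k}" for j
    proof -
      obtain f c where "\<And>x :: nat \<Rightarrow> 'a. x i =
          (\<Sum>l\<in>R j. c l * (\<Sum>t=1..Nl l. f l t * bucket_val n Nl G l x t))"
        using rec[OF j] by blast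
      then show ?thesis
        unfolding p_def V_def by (rule unit_form_in_span[OF i])
    qed
    show ?thesis
      by (rule triple_count_partition[OF k R mono[of i] pR]) (auto simp: good_def)
  qed
  then obtain h where good: "\<And>i. i \<in> {1..n} \<Longrightarrow> good i (h i)"
    by metis
  have h: "h i {a, b, c} \<le> triple_count (p i) a b c"
    if "i \<in> {1..n}" "a \<noteq> b" "a \<noteq> c" "b \<noteq> c" for i a b c
    using good that by (simp add: good_def)
  have sum_h: "(k - 2) * (k * (k + 1)) + 2 * k + 4 \<le> (\<Sum>T\<in>triples {1..k+2}. h i T)"
    if "i \<in> {1..n}" for i
    using good[OF that] by (simp add: good_def)
  have hT: "(\<Sum>i=1..n. h i T) \<le> 2 * (\<Sum>l\<in>T. Nl l)" if T3: "T \<in> triples {1..k+2}" for T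
  proof -
    obtain a b c where T: "T = {a, b, c}" "a \<noteq> b" "a \<noteq> c" "b \<noteq> c"
      using T3 card_3_iff[of T] by auto
    have "(\<Sum>i=1..n. h i T) \<le> (\<Sum>i=1..n. triple_count (p i) a b c)"
      using h T by (intro sum_mono) auto
    also have "\<dots> \<le> 2 * (\<Sum>l\<in>T. Nl l)"
      using triple[of a b c] T by (simp add: add.assoc)
    finally show ?thesis .
  qed
  have "n * ((k - 2) * (k * (k + 1)) + 2 * k + 4)
      = (\<Sum>i=1..n. (k - 2) * (k * (k + 1)) + 2 * k + 4)"
    by simp
  also have "\<dots> \<le> (\<Sum>i=1..n. \<Sum>T\<in>triples {1..k+2}. h i T)"
    by (rule sum_mono) (rule sum_h)
  also have "\<dots> = (\<Sum>T\<in>triples {1..k+2}. \<Sum>i=1..n. h i T)"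
    by (rule sum.swap)
  also have "\<dots> \<le> (\<Sum>T\<in>triples {1..k+2}. 2 * (\<Sum>l\<in>T. Nl l))"
    by (rule sum_mono) (rule hT)
  also have "\<dots> = 2 * (((k + 1) choose 2) * (\<Sum>l=1..k+2. Nl l))"
    unfolding sum_distrib_left[symmetric] by (subst sum_triples_sum) auto
  also have "(\<Sum>l=1..k+2. Nl l) = N"
    using code by (simp add: pir_array_code_def)
  also have "2 * (((k + 1) choose 2) * N) = k * (k + 1) * N"
    by (metis choose_two_double mult.assoc)
  finally show ?thesis .
qed

section \<open>Existence of codes\<close>

text \<open>Replicating the whole message in every bucket gives a code,
  so the minimum in the definition of \<^const>\<open>N_P\<close> is over a nonempty set.\<close>

lemma pir_array_code_exists:
  assumes "n \<ge> 1" "k \<ge> 1" "k \<le> m"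
  shows "\<exists>N Nl (G :: nat \<Rightarrow> nat \<Rightarrow> nat \<Rightarrow> 'a::{finite,field}). pir_array_code n N k m Nl G"
proof -
  \<comment> \<open>The last part absorbs all remaining buckets; recovery in part \<open>j\<close>
    reads bucket \<open>j\<close> alone.\<close>
  define R where "R j = (if j = k then {k..m} else {j})" for j
  have part: "is_partition_k m k R"
  proof -
    have "(\<Union>j\<in>{1..k}. R j) = {1..m}"
    proof safe
      fix l assume "l \<in> {1..m}"
      then have "l \<in> R (min l k)" "min l k \<in> {1..k}"
        using assms by (auto simp: R_def min_def)
      then show "l \<in> (\<Union>j\<in>{1..k}. R j)" by blast
    qed (use assms in \<open>auto simp: R_def split: if_splits\<close>)
    then show ?thesis
      using assms by (auto simp: is_partition_k_def R_def)
  qed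
  define G :: "nat \<Rightarrow> nat \<Rightarrow> nat \<Rightarrow> 'a" where "G l t s = of_bool (s = t)" for l t s
  have val: "bucket_val n (\<lambda>_. n) G l x t = x t" if "t \<in> {1..n}" for l x t
    using that by (simp add: bucket_val_def G_def of_bool_def if_distrib[of "\<lambda>y. y * _"] cong: if_cong)
  have "pir_array_code n (m * n) k m (\<lambda>_. n) G"
    unfolding pir_array_code_def
  proof (intro conjI ballI)
    fix i assume i: "i \<in> {1..n}"
    show "\<exists>R. is_partition_k m k R \<and> (\<forall>j\<in>{1..k}. \<exists>f c. \<forall>x. x i =
        (\<Sum>l\<in>R j. c l * (\<Sum>t=1..n. f l t * bucket_val n (\<lambda>_. n) G l x t)))"
    proof (intro exI[of _ R] conjI ballI part)
      fix j assume j: "j \<in> {1..k}"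
      then have jR: "j \<in> R j" "finite (R j)"
        using assms by (auto simp: R_def)
      have "x i = (\<Sum>l\<in>R j. of_bool (l = j) * (\<Sum>t=1..n. of_bool (t = i) * bucket_val n (\<lambda>_. n) G l x t))" for x
      proof -
        have "(\<Sum>t=1..n. of_bool (t = i) * bucket_val n (\<lambda>_. n) G l x t) = x i" for l
          using i by (simp add: val of_bool_def if_distrib[of "\<lambda>y. y * _"] cong: if_cong)
        then show ?thesis
          using jR by (simp add: of_bool_def if_distrib[of "\<lambda>y. y * _"] cong: if_cong)
      qed
      then show "\<exists>f c. \<forall>x. x i = (\<Sum>l\<in>R j. c l * (\<Sum>t=1..n. f l t * bucket_val n (\<lambda>_. n) G l x t))"
        by (intro exI[of _ "\<lambda>l t. of_bool (t = i)"] exI[of _ "\<lambda>l. of_bool (l = j)"]) blast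
    qed
  qed (use assms in auto)
  then show ?thesis by blast
qed

section \<open>Numerical comparison with the claimed bound\<close>

theorem theorem3p4:
  fixes n k :: nat
  assumes "n \<ge> 1" and "k \<ge> 3"
  shows "real (N_P TYPE('a::{finite,field}) n k (k + 2))
           \<ge> (real k - 2 + (4 * real k + 16) / (3 * (real k)\<^sup>2 + real k + 4)) * real n"
proof -
  define N where "N = N_P TYPE('a) n k (k + 2)"
  have "\<exists>N Nl (G :: nat \<Rightarrow> nat \<Rightarrow> nat \<Rightarrow> 'a). pir_array_code n N k (k + 2) Nl G"
    using assms by (intro pir_array_code_exists) auto
  then have "\<exists>Nl (G :: nat \<Rightarrow> nat \<Rightarrow> nat \<Rightarrow> 'a). pir_array_code n N k (k + 2) Nl G"
    unfolding N_def N_P_def by (rule LeastI_ex)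
  then have "n * ((k - 2) * (k * (k + 1)) + 2 * k + 4) \<le> k * (k + 1) * N"
    using pir_array_code_bound assms(2) by blast
  then have "real (n * ((k - 2) * (k * (k + 1)) + 2 * k + 4)) \<le> real (k * (k + 1) * N)"
    by (rule of_nat_mono)
  then have main: "real n * ((real k - 2) * (real k * (real k + 1)) + 2 * real k + 4)
      \<le> real k * (real k + 1) * real N"
  proof -
    have "real (k - 2) = real k - 2"
      using assms(2) by (simp add: of_nat_diff)
    then show ?thesis
      using \<open>real (n * _) \<le> _\<close> by (simp only: of_nat_add of_nat_mult of_nat_numeral of_nat_1)
  qed
  define K where "K = real k"
  have K: "K \<ge> 3" using assms(2) by (simp add: K_def)
  have pos: "K * (K + 1) > 0" "3 * K\<^sup>2 + K + 4 > 0"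
    using K by (auto intro!: add_nonneg_pos)
  \<comment> \<open>The right side minus the left side equals
    \<open>2 * (K * K - 2) * (K - 3) + 4\<close>.\<close>
  have "(4 * K + 16) * (K * (K + 1)) \<le> (2 * K + 4) * (3 * K\<^sup>2 + K + 4)"
  proof -
    have "9 \<le> K * K"
      using mult_mono[of 3 K 3 K] K by simp
    then have "0 \<le> (K * K - 2) * (K - 3)"
      using K by (intro mult_nonneg_nonneg) auto
    then show ?thesis
      by (simp add: algebra_simps power2_eq_square)
  qed
  then have "(4 * K + 16) / (3 * K\<^sup>2 + K + 4) \<le> (2 * K + 4) / (K * (K + 1))"
    using pos by (simp add: divide_le_eq le_divide_eq pos_divide_le_eq pos_le_divide_eq mult.commute)
  then have "(K - 2 + (4 * K + 16) / (3 * K\<^sup>2 + K + 4)) * real n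
      \<le> (K - 2 + (2 * K + 4) / (K * (K + 1))) * real n"
    by (intro mult_right_mono) auto
  also have "\<dots> \<le> real N"
    using main pos(1) unfolding K_def[symmetric]
    by (simp add: field_simps)
  finally show ?thesis
    by (simp add: K_def N_def)
qed

end
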